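(* For every (arbitrarily large) $m_0$ and every real parameter $\alpha$ with $0\le\alpha\le 1/5$, there are an integer $m\ge m_0$, a set of reals $\mathcal{A}\subset\mathbb{R}$ with $|\mathcal{A}|=m$, and a graph $G_m$ on $m$ vertices (identified with the elements of $\mathcal{A}$) with $$\tilde{\Omega}\left(m^{2-2\alpha}\right)$$ edges such that $$|\mathcal{A}+_{G_m}\mathcal{A}|+|\mathcal{A}\cdot_{G_m}\mathcal{A}|=\tilde{O}\left(|\mathcal{A}|^{2-4\alpha}\right).$$
   Context: Sums and products along a graph: let $G$ be a graph on $n$ vertices $v_1,\dots,v_n$ with edge set $E(G)$, and let $\mathcal{A}=\{a_1,\dots,a_n\}$ be an $n$-element set of real numbers, with $a_i$ assigned to $v_i$. The sumset of $\mathcal{A}$ along $G$ is $\mathcal{A}+_{G}\mathcal{A}=\{a_i+a_j \mid (i,j)\in E(G)\}$ and the product set of $\mathcal{A}$ along $G$ is $\mathcal{A}\cdot_{G}\mathcal{A}=\{a_i\cdot a_j \mid (i,j)\in E(G)\}$, where $(i,j)\in E(G)$ means that $v_i$ and $v_j$ are joined by an edge. Asymptotic notation: $f=\tilde{O}(g)$ means that there are absolute positive constants $c_1,c_2$ such that $f(n)\le c_1\, g(n)(\log g(n))^{c_2}$ for all admissible values of $n$. The notation $f=\tilde{\Omega}(g)$ means $g=\tilde{O}(f)$. *)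

theory Defs
  imports Complex_Main
begin

definition simple_graph :: "'a set \<Rightarrow> 'a set set \<Rightarrow> bool" where
  "simple_graph V E \<longleftrightarrow> (\<forall>e\<in>E. \<exists>u v. u \<in> V \<and> v \<in> V \<and> u \<noteq> v \<and> e = {u, v})"

text \<open>The vertices are the elements of \<open>A\<close> themselves, so the number assigned to a vertex
  is the vertex.\<close>

definition sumset_along :: "'a::plus set \<Rightarrow> 'a set set \<Rightarrow> 'a set" where
  "sumset_along A E = {a + b | a b. a \<in> A \<and> b \<in> A \<and> {a, b} \<in> E}"

definition prodset_along :: "'a::times set \<Rightarrow> 'a set set \<Rightarrow> 'a set" where
  "prodset_along A E = {a * b | a b. a \<in> A \<and> b \<in> A \<and> {a, b} \<in> E}"

text \<open>The inequality behind the soft asymptotic notation: \<open>f = O~(g)\<close> holds when there are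
  positive constants \<open>c\<^sub>1\<close>, \<open>c\<^sub>2\<close> with \<open>soft_O_bound c\<^sub>1 c\<^sub>2 (f x) (g x)\<close> for all
  admissible \<open>x\<close>, and \<open>f = Omega~(g)\<close> when the same is true of
  \<open>soft_Omega_bound c\<^sub>1 c\<^sub>2 (f x) (g x)\<close>. The constants are parameters, so that a statement
  has to quantify over them explicitly, ahead of everything they must not depend on.\<close>

definition soft_O_bound :: "real \<Rightarrow> real \<Rightarrow> real \<Rightarrow> real \<Rightarrow> bool" where
  "soft_O_bound c1 c2 f g \<longleftrightarrow> f \<le> c1 * g * (ln g) powr c2"

definition soft_Omega_bound :: "real \<Rightarrow> real \<Rightarrow> real \<Rightarrow> real \<Rightarrow> bool" where
  "soft_Omega_bound c1 c2 f g \<longleftrightarrow> soft_O_bound c1 c2 g f"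

end

theory Submission
  imports Defs "HOL-Analysis.Convex" "HOL-Real_Asymp.Real_Asymp"
begin

text \<open>
  The idea is to make products along edges small integers, and sums along edges short fractions
  over square roots of small integers. An edge joins \<open>u * x\<close> to \<open>z / x\<close>, where
  \<open>x = sqrt (w / v)\<close>, the integers \<open>u\<close>, \<open>z\<close> are of size \<open>M\<close> and the integers \<open>w\<close>, \<open>v\<close> are of
  size \<open>N\<close>. The product of the ends is \<open>u * z\<close>, which takes \<open>O(M\<^sup>2)\<close> values. The sum is
  \<open>(u * w + z * v) / sqrt (w * v)\<close>, which takes \<open>O(M * N * N\<^sup>2)\<close> values, since the numerator is
  \<open>O(M * N)\<close> and \<open>w * v\<close> is \<open>O(N\<^sup>2)\<close>. There are \<open>O(M * N\<^sup>2)\<close> vertices, and, up to coincidences,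
  \<open>M\<^sup>2 * N\<^sup>2\<close> edges. With \<open>N = n powr \<alpha>\<close> and \<open>M = n powr (1 - 2 * \<alpha>)\<close> this is \<open>O(n)\<close> vertices,
  \<open>n powr (2 - 2 * \<alpha>)\<close> edges, \<open>O(n powr (2 - 4 * \<alpha>))\<close> products and \<open>O(n powr (1 + \<alpha>))\<close> sums; and
  \<open>1 + \<alpha> \<le> 2 - 4 * \<alpha>\<close> says exactly that \<open>\<alpha> \<le> 1 / 5\<close>.

  It remains to see that coincidences cost only logarithms. By the Cauchy-Schwarz inequality
  (\<open>card_squared_le_image_times_collisions\<close>) it is enough to bound the number of pairs of
  parameters that give the same object. Two pairs \<open>(w, v)\<close> with the same quotient, and likewise
  two triples \<open>(u, z, x)\<close> with the same edge, produce a relation \<open>a * b = c * d\<close> among four small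
  positive integers: for edges, it is the equality of the products \<open>u * z\<close>. The number of solutions
  with all entries at most \<open>K\<close> exceeds the trivial \<open>K\<^sup>2\<close> by a factor \<open>(1 + ln K)\<^sup>2\<close> at most
  (\<open>card_mult_quadruples_le\<close>).

  Since the number of vertices obtained is at most \<open>2 * n\<close>, isolated vertices bring it to \<open>2 * n\<close>;
  they change neither the sums nor the products along the edges.
\<close>

section \<open>Counting distinct values by counting coincidences\<close>

text \<open>The sizes of the fibres of \<open>f\<close> add up to the size of \<open>T\<close>, and their squares add up to the
  number of coincidences; Cauchy-Schwarz compares the two sums. This turns an upper bound for
  coincidences into a lower bound for the number of distinct values.\<close>

lemma card_squared_le_image_times_collisions:
  assumes "finite T"
  shows "(card T)\<^sup>2 \<le> card (f ` T) * card {(s, t). s \<in> T \<and> t \<in> T \<and> f s = f t}"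
proof -
  define F where "F y = {t \<in> T. f t = y}" for y
  have finF: "finite (F y)" for y
    using assms by (simp add: F_def)
  have "T = (\<Union>y\<in>f ` T. F y)"
    by (auto simp: F_def)
  also have "card \<dots> = (\<Sum>y\<in>f ` T. card (F y))"
    using assms finF by (intro card_UN_disjoint) (auto simp: F_def)
  finally have T: "card T = (\<Sum>y\<in>f ` T. card (F y))" .
  have "{(s, t). s \<in> T \<and> t \<in> T \<and> f s = f t} = (\<Union>y\<in>f ` T. F y \<times> F y)"
    by (auto simp: F_def)
  also have "card \<dots> = (\<Sum>y\<in>f ` T. card (F y \<times> F y))"
    using assms finF by (intro card_UN_disjoint) (auto simp: F_def)
  finally have C: "card {(s, t). s \<in> T \<and> t \<in> T \<and> f s = f t} = (\<Sum>y\<in>f ` T. (card (F y))\<^sup>2)"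
    by (simp add: card_cartesian_product power2_eq_square)
  have "real ((card T)\<^sup>2) \<le> real (card (f ` T) * card {(s, t). s \<in> T \<and> t \<in> T \<and> f s = f t})"
    using sum_squared_le_sum_of_squares[of "\<lambda>y. real (card (F y))" "f ` T"]
    by (simp add: T C mult.commute)
  then show ?thesis
    by (simp only: of_nat_le_iff)
qed

section \<open>Multiplicative coincidences among small integers\<close>

definition mult_quadruples :: "nat \<Rightarrow> (nat \<times> nat \<times> nat \<times> nat) set" where
  "mult_quadruples K =
     {(a, b, c, d). {a, b, c, d} \<subseteq> {1..K} \<and> a * b = c * d}"

lemma finite_mult_quadruples: "finite (mult_quadruples K)"
proof (rule finite_subset)
  show "mult_quadruples K \<subseteq> {1..K} \<times> {1..K} \<times> {1..K} \<times> {1..K}"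
    by (auto simp: mult_quadruples_def)
qed auto

lemma sum_inverse_le_ln:
  assumes "K \<ge> 1"
  shows "(\<Sum>p = 1..K. 1 / real p) \<le> 1 + ln (real K)"
  using assms
proof (induction K rule: dec_induct)
  case base
  then show ?case by simp
next
  case (step n)
  have n: "real n > 0" using step by simp
  have "ln (real n / real (Suc n)) \<le> real n / real (Suc n) - 1"
    using n by (intro ln_le_minus_one) simp
  then have "1 / real (Suc n) \<le> ln (real (Suc n)) - ln (real n)"
    using n by (simp add: ln_div field_simps)
  then show ?case
    using step by simp
qed

text \<open>For each \<open>p\<close> there are \<open>K div p\<close> choices of \<open>g\<close>, so that the count is a harmonic sum.\<close>

lemma card_hyperbola_le:
  assumes "K \<ge> 1"
  shows "real (card {(g, p). g \<in> {1..K} \<and> p \<in> {1..K} \<and> g * p \<le> K}) \<le> real K * (1 + ln (real K))"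
proof -
  have "{(g, p). g \<in> {1..K} \<and> p \<in> {1..K} \<and> g * p \<le> K}
      \<subseteq> prod.swap ` (SIGMA p:{1..K}. {1..K div p})"
    by (auto simp: less_eq_div_iff_mult_less_eq image_iff)
  then have "card {(g, p). g \<in> {1..K} \<and> p \<in> {1..K} \<and> g * p \<le> K}
      \<le> card (prod.swap ` (SIGMA p:{1..K}. {1..K div p}))"
    by (intro card_mono) auto
  also have "\<dots> \<le> card (SIGMA p:{1..K}. {1..K div p})"
    by (intro card_image_le) auto
  also have "\<dots> = (\<Sum>p = 1..K. K div p)"
    by simp
  finally have "real (card {(g, p). g \<in> {1..K} \<and> p \<in> {1..K} \<and> g * p \<le> K})
      \<le> (\<Sum>p = 1..K. real (K div p))"
    by (simp flip: of_nat_sum)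
  also have "\<dots> \<le> (\<Sum>p = 1..K. real K * (1 / real p))"
    by (intro sum_mono) (simp add: of_nat_div_le_of_nat)
  also have "\<dots> = real K * (\<Sum>p = 1..K. 1 / real p)"
    by (simp only: sum_distrib_left)
  also have "\<dots> \<le> real K * (1 + ln (real K))"
    using sum_inverse_le_ln[OF assms] by (intro mult_left_mono) auto
  finally show ?thesis .
qed

text \<open>A solution of \<open>a * b = c * d\<close> splits as \<open>a = g * p\<close>, \<open>b = h * q\<close>, \<open>c = g * q\<close>,
  \<open>d = h * p\<close>. So it is determined by the two factorizations of \<open>a\<close> and \<open>b\<close>, each of which is a
  lattice point under the hyperbola.\<close>

lemma card_mult_quadruples_le:
  assumes "K \<ge> 1"
  shows "real (card (mult_quadruples K)) \<le> (real K * (1 + ln (real K)))\<^sup>2"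
proof -
  define H where "H = {(g, p). g \<in> {1..K} \<and> p \<in> {1..K} \<and> g * p \<le> K}"
  have finH: "finite H"
    by (rule finite_subset[of _ "{1..K} \<times> {1..K}"]) (auto simp: H_def)
  have "mult_quadruples K \<subseteq> (\<lambda>((g, p), (h, q)). (g * p, h * q, g * q, h * p)) ` (H \<times> H)"
  proof
    fix t assume t: "t \<in> mult_quadruples K"
    obtain a b c d where abcd: "t = (a, b, c, d)"
      by (cases t)
    have range: "a \<in> {1..K}" "b \<in> {1..K}" "c \<in> {1..K}" "d \<in> {1..K}" and eq: "a * b = c * d"
      using t by (auto simp: abcd mult_quadruples_def)
    have "c dvd a * b"
      using eq by simp
    then obtain g q where gq: "c = g * q" "g dvd a" "q dvd b"
      using division_decomp by blast
    obtain p where p: "a = g * p" using gq by auto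
    obtain h where h: "b = h * q" using gq by (metis dvdE mult.commute)
    have pos: "g > 0" "p > 0" "h > 0" "q > 0"
      using range p h by (auto intro!: Nat.gr0I)
    have d: "d = h * p"
      using eq pos by (simp add: gq p h mult.commute)
    have prods: "g * p \<le> K" "h * q \<le> K"
      using range p h by auto
    have "g \<le> g * p" "p \<le> g * p" "h \<le> h * q" "q \<le> h * q"
      using pos by auto
    then have "g \<le> K" "p \<le> K" "h \<le> K" "q \<le> K"
      using prods by linarith+
    then have "(g, p) \<in> H" "(h, q) \<in> H"
      using prods pos by (auto simp: H_def)
    then show "t \<in> (\<lambda>((g, p), (h, q)). (g * p, h * q, g * q, h * p)) ` (H \<times> H)"
      unfolding abcd gq(1) p h d by force
  qed
  then have "card (mult_quadruples K) \<le> card (H \<times> H)"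
    using finH by (intro surj_card_le) auto
  then have "real (card (mult_quadruples K)) \<le> (real (card H))\<^sup>2"
    by (simp add: card_cartesian_product power2_eq_square flip: of_nat_mult)
  also have "\<dots> \<le> (real K * (1 + ln (real K)))\<^sup>2"
    using card_hyperbola_le[OF assms] by (intro power_mono) (auto simp: H_def)
  finally show ?thesis .
qed

section \<open>The vertex scale factors\<close>

text \<open>The ranges of numerators and denominators are disjoint so that every scale factor is less
  than 1; this tells the two ends of an edge apart.\<close>

definition ratio_roots :: "nat \<Rightarrow> real set" where
  "ratio_roots N = (\<lambda>(w, v). sqrt (real w / real v)) ` ({1..N} \<times> {N + 1..2 * N})"

lemma finite_ratio_roots [simp]: "finite (ratio_roots N)"
  by (simp add: ratio_roots_def)

lemma ratio_roots_bounds: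
  assumes "x \<in> ratio_roots N"
  shows "0 < x" "x < 1"
  using assms by (auto simp: ratio_roots_def)

lemma card_ratio_roots_le: "card (ratio_roots N) \<le> N\<^sup>2"
proof -
  have "card (ratio_roots N) \<le> card ({1..N} \<times> {N + 1..2 * N})"
    unfolding ratio_roots_def by (rule card_image_le) auto
  then show ?thesis
    by (simp add: card_cartesian_product power2_eq_square)
qed

text \<open>Equal quotients \<open>w / v = w' / v'\<close> give \<open>w * v' = w' * v\<close>, a multiplicative coincidence
  among integers up to \<open>2 * N\<close>. So the \<open>N\<^sup>2\<close> pairs of integers yield \<open>N\<^sup>2\<close> distinct factors,
  up to logarithms.\<close>

lemma card_ratio_roots_ge:
  assumes "N \<ge> 1"
  shows "(real N)\<^sup>2 \<le> real (card (ratio_roots N)) * (4 * (1 + ln (real (2 * N)))\<^sup>2)"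
proof -
  define T where "T = {1..N} \<times> {N + 1..2 * N}"
  define f where "f = (\<lambda>(w, v). sqrt (real w / real v))"
  define C where "C = {(s, t). s \<in> T \<and> t \<in> T \<and> f s = f t}"
  define r where "r = (\<lambda>((w, v), (w', v')). (w, v', w', v) :: nat \<times> nat \<times> nat \<times> nat)"
  have "inj_on r C"
    by (auto simp: inj_on_def r_def)
  moreover have "r ` C \<subseteq> mult_quadruples (2 * N)"
  proof (clarsimp simp: C_def r_def)
    fix w v w' v' :: nat
    assume T: "(w, v) \<in> T" "(w', v') \<in> T" and "f (w, v) = f (w', v')"
    then have "real w / real v = real w' / real v'"
      by (simp add: f_def)
    then have "real (w * v') = real (w' * v)"
      using T by (simp add: T_def field_simps)
    then have "w * v' = w' * v"
      by (simp only: of_nat_eq_iff)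
    then show "(w, v', w', v) \<in> mult_quadruples (2 * N)"
      using T by (auto simp: mult_quadruples_def T_def)
  qed
  ultimately have C: "card C \<le> card (mult_quadruples (2 * N))"
    using card_inj_on_le finite_mult_quadruples by blast
  have "real ((card T)\<^sup>2) \<le> real (card (f ` T) * card C)"
    unfolding C_def by (intro of_nat_mono card_squared_le_image_times_collisions) (simp add: T_def)
  moreover have "f ` T = ratio_roots N"
    by (simp add: T_def f_def ratio_roots_def)
  moreover have "card T = N\<^sup>2"
    by (simp add: T_def card_cartesian_product power2_eq_square)
  ultimately have "(real N)\<^sup>2 * (real N)\<^sup>2 \<le> real (card (ratio_roots N)) * real (card C)"
    by (simp add: power2_eq_square)
  also have "\<dots> \<le> real (card (ratio_roots N)) * (real (2 * N) * (1 + ln (real (2 * N))))\<^sup>2"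
    using C card_mult_quadruples_le[of "2 * N"] assms
    by (intro mult_left_mono) auto
  also have "\<dots> = (real N)\<^sup>2 * (real (card (ratio_roots N)) * (4 * (1 + ln (real (2 * N)))\<^sup>2))"
    by (simp add: power_mult_distrib)
  finally show ?thesis
    by (rule mult_left_le_imp_le) (use assms in simp)
qed

section \<open>The graph\<close>

definition link :: "nat \<times> nat \<times> real \<Rightarrow> real set" where
  "link = (\<lambda>(u, z, x). {real u * x, real z / x})"

definition link_params :: "nat \<Rightarrow> nat \<Rightarrow> (nat \<times> nat \<times> real) set" where
  "link_params M N = {1..M} \<times> {M + 1..2 * M} \<times> ratio_roots N"

definition ratio_vertices :: "nat \<Rightarrow> nat \<Rightarrow> real set" where
  "ratio_vertices M N =
     (\<lambda>(u, x). real u * x) ` ({1..M} \<times> ratio_roots N) \<union>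
     (\<lambda>(z, x). real z / x) ` ({M + 1..2 * M} \<times> ratio_roots N)"

lemma finite_link_params [simp]: "finite (link_params M N)"
  by (simp add: link_params_def)

lemma finite_ratio_vertices [simp]: "finite (ratio_vertices M N)"
  by (simp add: ratio_vertices_def)

lemma card_ratio_vertices_le: "card (ratio_vertices M N) \<le> 2 * (M * N\<^sup>2)"
proof -
  have "card (ratio_vertices M N) \<le>
      card ((\<lambda>(u, x). real u * x) ` ({1..M} \<times> ratio_roots N)) +
      card ((\<lambda>(z, x). real z / x) ` ({M + 1..2 * M} \<times> ratio_roots N))"
    unfolding ratio_vertices_def by (rule card_Un_le)
  also have "\<dots> \<le> card ({1..M} \<times> ratio_roots N) + card ({M + 1..2 * M} \<times> ratio_roots N)"
    by (intro add_mono card_image_le) auto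
  also have "\<dots> = 2 * (M * card (ratio_roots N))"
    by (simp add: card_cartesian_product)
  also have "\<dots> \<le> 2 * (M * N\<^sup>2)"
    using card_ratio_roots_le by simp
  finally show ?thesis .
qed

text \<open>The smaller end of an edge is thus always the one of the form \<open>u * x\<close>. So there are no loops,
  and an edge, although an unordered pair, determines which end is which.\<close>

lemma link_ends_less:
  assumes "(u, z, x) \<in> link_params M N"
  shows "real u * x < real z / x"
proof -
  have x: "0 < x" "x < 1" and uz: "1 \<le> u" "u < z"
    using assms by (auto simp: link_params_def dest: ratio_roots_bounds)
  have "real u * x \<le> real u * 1"
    using x by (intro mult_left_mono) auto
  also have "\<dots> < real z"
    using uz by simp
  also have "\<dots> \<le> real z / x"
    using x uz by (simp add: pos_le_divide_eq mult_left_le)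
  finally show ?thesis .
qed

lemma simple_graph_links:
  assumes "ratio_vertices M N \<subseteq> A"
  shows "simple_graph A (link ` link_params M N)"
  unfolding simple_graph_def
proof clarify
  fix u z x assume t: "(u, z, x) \<in> link_params M N"
  then have "real u * x \<in> ratio_vertices M N" "real z / x \<in> ratio_vertices M N"
    by (force simp: ratio_vertices_def link_params_def)+
  then have "real u * x \<in> A" "real z / x \<in> A"
    using assms by auto
  then show "\<exists>a b. a \<in> A \<and> b \<in> A \<and> a \<noteq> b \<and> link (u, z, x) = {a, b}"
    using link_ends_less[OF t] unfolding link_def
    by (intro exI[of _ "real u * x"] exI[of _ "real z / x"]) simp
qed

text \<open>Two triples \<open>(u, z, x)\<close> and \<open>(u', z', x')\<close> with the same edge have the same product of the
  ends, \<open>u * z = u' * z'\<close>. Given these four integers and \<open>x\<close>, the factor \<open>x'\<close> is determined by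
  \<open>u * x = u' * x'\<close>. So there are at most as many coincidences as there are solutions of
  \<open>u * z = u' * z'\<close> times the number of scale factors, whatever the scale factors are.\<close>

lemma card_links_ge_ratio_roots:
  assumes "M \<ge> 1"
  shows "(real M)\<^sup>2 * real (card (ratio_roots N))
    \<le> real (card (link ` link_params M N)) * (4 * (1 + ln (real (2 * M)))\<^sup>2)"
proof (cases "ratio_roots N = {}")
  case False
  define R where "R = real (card (ratio_roots N))"
  define T where "T = link_params M N"
  define C where "C = {(s, t). s \<in> T \<and> t \<in> T \<and> link s = link t}"
  define r where "r = (\<lambda>((u, z, x), (u', z', x' :: real)). ((u, z, u', z'), x)
    :: (nat \<times> nat \<times> nat \<times> nat) \<times> real)"
  have R: "R > 0"
    using False by (simp add: R_def card_gt_0_iff)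
  have coincidence: "real u * x = real u' * x' \<and> u * z = u' * z'"
    if "(u, z, x) \<in> T" "(u', z', x') \<in> T" "link (u, z, x) = link (u', z', x')" for u z x u' z' x'
  proof -
    have x: "x > 0" "x' > 0"
      using that by (auto simp: T_def link_params_def dest: ratio_roots_bounds)
    have eq: "real u * x = real u' * x'" "real z / x = real z' / x'"
      using that link_ends_less[of u z x M N] link_ends_less[of u' z' x' M N]
      by (auto simp: link_def doubleton_eq_iff T_def)
    have "real u * real z = (real u * x) * (real z / x)"
      using x by simp
    also have "\<dots> = real u' * real z'"
      unfolding eq using x by simp
    finally have "real (u * z) = real (u' * z')"
      by simp
    then show ?thesis
      using eq by (simp only: of_nat_eq_iff)
  qed
  have "inj_on r C"
  proof (rule inj_onI)
    fix s t assume s: "s \<in> C" and t: "t \<in> C" and eq: "r s = r t"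
    obtain u z x u' z' x' where s': "s = ((u, z, x), (u', z', x'))"
      by (metis surj_pair)
    obtain y' where t': "t = ((u, z, x), (u', z', y'))"
      using eq by (cases t) (auto simp: r_def s')
    have "real u' * x' = real u' * y'"
      using coincidence[of u z x u' z' x'] coincidence[of u z x u' z' y'] s t
      by (auto simp: C_def s' t')
    moreover have "u' \<ge> 1"
      using s by (auto simp: C_def s' T_def link_params_def)
    ultimately show "s = t"
      by (simp add: s' t')
  qed
  moreover have "r ` C \<subseteq> mult_quadruples (2 * M) \<times> ratio_roots N"
  proof (clarsimp simp: C_def r_def, intro conjI)
    fix u z u' z' :: nat and x x' :: real
    assume T: "(u, z, x) \<in> T" "(u', z', x') \<in> T" and eq: "link (u, z, x) = link (u', z', x')"
    show "(u, z, u', z') \<in> mult_quadruples (2 * M)"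
      using T coincidence[OF T eq] by (auto simp: mult_quadruples_def T_def link_params_def)
    show "x \<in> ratio_roots N"
      using T by (simp add: T_def link_params_def)
  qed
  ultimately have "card C \<le> card (mult_quadruples (2 * M) \<times> ratio_roots N)"
    by (rule card_inj_on_le) (simp add: finite_mult_quadruples)
  then have "real (card C) \<le> real (card (mult_quadruples (2 * M))) * R"
    by (simp add: card_cartesian_product R_def flip: of_nat_mult)
  also have "\<dots> \<le> (real (2 * M) * (1 + ln (real (2 * M))))\<^sup>2 * R"
    using card_mult_quadruples_le[of "2 * M"] assms R by (intro mult_right_mono) auto
  finally have C: "real (card C) \<le> (real (2 * M) * (1 + ln (real (2 * M))))\<^sup>2 * R" .
  have "real ((card T)\<^sup>2) \<le> real (card (link ` T) * card C)"
    unfolding C_def by (intro of_nat_mono card_squared_le_image_times_collisions) (simp add: T_def)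
  moreover have "real (card T) = (real M)\<^sup>2 * R"
    by (simp add: T_def link_params_def card_cartesian_product power2_eq_square R_def)
  ultimately have "((real M)\<^sup>2 * R) * ((real M)\<^sup>2 * R) \<le> real (card (link ` T)) * real (card C)"
    by (simp add: power2_eq_square)
  also have "\<dots> \<le> real (card (link ` T)) * ((real (2 * M) * (1 + ln (real (2 * M))))\<^sup>2 * R)"
    using C by (intro mult_left_mono) auto
  also have "\<dots> = (real M)\<^sup>2 * R * (real (card (link ` T)) * (4 * (1 + ln (real (2 * M)))\<^sup>2))"
    by (simp add: power_mult_distrib)
  finally show ?thesis
    using assms R by (simp add: R_def T_def)
qed simp

lemma sumset_along_links:
  assumes "s \<in> sumset_along A (link ` P)"
  obtains u z x where "(u, z, x) \<in> P" "s = real u * x + real z / x"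
  using assms by (fastforce simp: sumset_along_def link_def doubleton_eq_iff)

lemma prodset_along_links:
  assumes "s \<in> prodset_along A (link ` P)"
  obtains u z x where "(u, z, x) \<in> P" "s = (real u * x) * (real z / x)"
  using assms by (fastforce simp: prodset_along_def link_def doubleton_eq_iff)

text \<open>For \<open>x = sqrt (w / v)\<close> the sum \<open>u * x + z / x\<close> equals \<open>(u * w + z * v) / sqrt (w * v)\<close>, where
  \<open>u * w + z * v \<le> M * N + (2 * M) * (2 * N)\<close> and \<open>w * v \<le> 2 * N\<^sup>2\<close>.\<close>

lemma card_sumset_links_le: "card (sumset_along A (link ` link_params M N)) \<le> 10 * (M * N ^ 3)"
proof -
  have "sumset_along A (link ` link_params M N)
      \<subseteq> (\<lambda>(s, k). real s / sqrt (real k)) ` ({1..5 * (M * N)} \<times> {1..2 * N\<^sup>2})"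
  proof
    fix y assume "y \<in> sumset_along A (link ` link_params M N)"
    then obtain u z x where t: "(u, z, x) \<in> link_params M N" and y: "y = real u * x + real z / x"
      by (rule sumset_along_links)
    obtain w v where wv: "w \<in> {1..N}" "v \<in> {N + 1..2 * N}" and x: "x = sqrt (real w / real v)"
      using t by (auto simp: link_params_def ratio_roots_def)
    have uz: "u \<in> {1..M}" "z \<in> {M + 1..2 * M}"
      using t by (auto simp: link_params_def)
    have "y = (real u * (sqrt w)\<^sup>2 + real z * (sqrt v)\<^sup>2) / (sqrt w * sqrt v)"
      using wv by (simp add: y x real_sqrt_divide field_simps power2_eq_square)
    then have "y = real (u * w + z * v) / sqrt (real (w * v))"
      by (simp add: real_sqrt_mult)
    moreover have "u * w \<le> M * N" "z * v \<le> (2 * M) * (2 * N)" "w * v \<le> N * (2 * N)"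
      using uz wv by (intro mult_mono; simp)+
    moreover have "1 \<le> u * w + z * v" "1 \<le> w * v"
      using uz wv by (auto simp: Suc_le_eq)
    ultimately show "y \<in> (\<lambda>(s, k). real s / sqrt (real k)) ` ({1..5 * (M * N)} \<times> {1..2 * N\<^sup>2})"
      by (intro image_eqI[of _ _ "(u * w + z * v, w * v)"]) (auto simp: power2_eq_square)
  qed
  then have "card (sumset_along A (link ` link_params M N)) \<le> card ({1..5 * (M * N)} \<times> {1..2 * N\<^sup>2})"
    by (intro surj_card_le) auto
  then show ?thesis
    by (simp add: card_cartesian_product power2_eq_square power3_eq_cube mult_ac)
qed

lemma card_prodset_links_le: "card (prodset_along A (link ` link_params M N)) \<le> 2 * M\<^sup>2"
proof -
  have "prodset_along A (link ` link_params M N) \<subseteq> real ` {1..2 * M\<^sup>2}"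
  proof
    fix y assume "y \<in> prodset_along A (link ` link_params M N)"
    then obtain u z x where t: "(u, z, x) \<in> link_params M N" and y: "y = (real u * x) * (real z / x)"
      by (rule prodset_along_links)
    have "x > 0" and uz: "u \<in> {1..M}" "z \<in> {M + 1..2 * M}"
      using t by (auto simp: link_params_def dest: ratio_roots_bounds)
    then have "y = real (u * z)"
      by (simp add: y)
    moreover have "u * z \<le> M * (2 * M)"
      using uz by (intro mult_mono) auto
    moreover have "1 \<le> u * z"
      using uz by (simp add: Suc_le_eq)
    ultimately show "y \<in> real ` {1..2 * M\<^sup>2}"
      by (intro image_eqI[of _ _ "u * z"]) (auto simp: power2_eq_square)
  qed
  then have "card (prodset_along A (link ` link_params M N)) \<le> card {1..2 * M\<^sup>2}"
    by (intro surj_card_le) auto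
  then show ?thesis
    by simp
qed

lemma card_links_ge:
  assumes "M \<ge> 1" "N \<ge> 1"
  shows "(real M)\<^sup>2 * (real N)\<^sup>2 \<le> real (card (link ` link_params M N)) *
     (16 * (1 + ln (real (2 * M)))\<^sup>2 * (1 + ln (real (2 * N)))\<^sup>2)"
proof -
  have "(real M)\<^sup>2 * (real N)\<^sup>2 \<le>
      (real M)\<^sup>2 * real (card (ratio_roots N)) * (4 * (1 + ln (real (2 * N)))\<^sup>2)"
    using mult_left_mono[OF card_ratio_roots_ge[OF assms(2)], of "(real M)\<^sup>2"]
    by (simp add: mult.assoc)
  also have "\<dots> \<le> (real (card (link ` link_params M N)) * (4 * (1 + ln (real (2 * M)))\<^sup>2)) *
      (4 * (1 + ln (real (2 * N)))\<^sup>2)"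
    by (intro mult_right_mono card_links_ge_ratio_roots assms) auto
  finally show ?thesis
    by (simp add: mult_ac)
qed

section \<open>Choice of the parameters\<close>

lemma floor_powr_bounds:
  fixes n :: nat and \<beta> :: real
  assumes "n \<ge> 1" "\<beta> \<ge> 0"
  defines "K \<equiv> nat \<lfloor>real n powr \<beta>\<rfloor>"
  shows "K \<ge> 1" "real K \<le> real n powr \<beta>" "real n powr \<beta> \<le> 2 * real K"
proof -
  have 1: "1 \<le> real n powr \<beta>"
    using assms by (simp add: ge_one_powr_ge_zero)
  then have K: "real K = of_int \<lfloor>real n powr \<beta>\<rfloor>"
    by (simp add: K_def)
  have "\<lfloor>real n powr \<beta>\<rfloor> \<ge> 1"
    using 1 by simp
  then show "K \<ge> 1" "real K \<le> real n powr \<beta>" "real n powr \<beta> \<le> 2 * real K"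
    unfolding K using K_def by linarith+
qed

lemma polylog_eventually_small:
  "\<exists>n0. \<forall>n\<ge>n0. 1024 * (1 + ln (real n)) ^ 4 \<le> real n powr (3 / 5)"
proof -
  have "eventually (\<lambda>n. 1024 * (1 + ln (real n)) ^ 4 \<le> real n powr (3 / 5)) at_top"
    by real_asymp
  then show ?thesis
    by (simp add: eventually_at_top_linorder)
qed

text \<open>The soft bound measures the loss in \<open>ln e\<close>, whereas the construction loses a power of
  \<open>ln m\<close>. This is harmless because \<open>e\<close> is at least \<open>m\<close>: the exponent \<open>2 - 2 * \<alpha>\<close> is at least
  \<open>8 / 5\<close>, and the surplus \<open>m powr (3 / 5)\<close> absorbs the logarithms. The threshold for \<open>m\<close> is the
  same for all \<open>\<alpha>\<close>.\<close>

lemma soft_Omega_bound_of_polylog_loss: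
  assumes m: "exp 1 \<le> m" and small: "1024 * (1 + ln m) ^ 4 \<le> m powr (3 / 5)"
    and \<alpha>: "\<alpha> \<le> 1 / 5" and edges: "m powr (2 - 2 * \<alpha>) \<le> 1024 * (1 + ln m) ^ 4 * e"
  shows "soft_Omega_bound 16384 4 e (m powr (2 - 2 * \<alpha>))"
proof -
  have m1: "m \<ge> 1"
    by (rule order_trans[OF _ m]) simp
  then have ln1: "1 \<le> ln m"
    using m by (simp add: ln_ge_iff)
  define P where "P = 1024 * (1 + ln m) ^ 4"
  have P: "P > 0"
    using ln1 by (simp add: P_def)
  have "P * m \<le> m powr (3 / 5) * m"
    using small m1 by (simp add: P_def)
  also have "\<dots> = m powr (8 / 5)"
    using m1 powr_add[of m "3 / 5" 1] by simp
  also have "\<dots> \<le> m powr (2 - 2 * \<alpha>)"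
    using m1 \<alpha> by (intro powr_mono) auto
  also have "\<dots> \<le> P * e"
    using edges by (simp add: P_def)
  finally have me: "m \<le> e"
    using P by simp
  have e: "e > 0" and ln_le: "ln m \<le> ln e"
    using me m1 by auto
  have "1 + ln m \<le> 2 * ln e"
    using ln1 ln_le by simp
  then have "(1 + ln m) ^ 4 \<le> (2 * ln e) ^ 4"
    using ln1 by (intro power_mono) auto
  also have "\<dots> = 16 * ln e powr 4"
    using powr_realpow[of "ln e" 4] ln1 ln_le by (simp add: power_mult_distrib)
  finally have log_le: "(1 + ln m) ^ 4 \<le> 16 * ln e powr 4" .
  have "m powr (2 - 2 * \<alpha>) \<le> 1024 * (1 + ln m) ^ 4 * e"
    by (rule edges)
  also have "\<dots> \<le> 1024 * (16 * ln e powr 4) * e"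
    using e by (intro mult_right_mono mult_left_mono log_le) auto
  also have "\<dots> = 16384 * e * ln e powr 4"
    by simp
  finally show ?thesis
    unfolding soft_Omega_bound_def soft_O_bound_def .
qed

lemma soft_O_bound_of_le:
  assumes m: "exp 1 \<le> m" and \<beta>: "\<beta> \<ge> 1" and c: "c \<ge> 0" and le: "f \<le> c * m powr \<beta>"
  shows "soft_O_bound c 1 f (m powr \<beta>)"
proof -
  have m1: "m \<ge> 1"
    by (rule order_trans[OF _ m]) simp
  then have ln1: "1 \<le> ln m"
    using m by (simp add: ln_ge_iff)
  have "1 * 1 \<le> \<beta> * ln m"
    using \<beta> ln1 by (intro mult_mono) auto
  then have ln_g: "1 \<le> ln (m powr \<beta>)"
    using m1 by (simp add: ln_powr)
  have "c * m powr \<beta> * 1 \<le> c * m powr \<beta> * ln (m powr \<beta>) powr 1"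
    using ln_g c by (intro mult_left_mono) auto
  with le show ?thesis
    by (simp add: soft_O_bound_def)
qed

text \<open>The loss \<open>1024 = 4 * 16 * 16\<close> comes from replacing \<open>n\<close> by \<open>2 * n\<close>, from rounding \<open>M\<close> and
  \<open>N\<close> down, and from the coincidences among edges and among scale factors.\<close>

lemma ratio_graph_exists:
  fixes n :: nat and \<alpha> :: real
  assumes n: "n \<ge> 1" and \<alpha>: "0 \<le> \<alpha>" "\<alpha> \<le> 1 / 5"
  shows "\<exists>(A::real set) E. finite A \<and> card A = 2 * n \<and> simple_graph A E \<and>
    real (2 * n) powr (2 - 2 * \<alpha>) \<le> 1024 * (1 + ln (real (2 * n))) ^ 4 * real (card E) \<and>
    real (card (sumset_along A E)) + real (card (prodset_along A E))
      \<le> 12 * real (2 * n) powr (2 - 4 * \<alpha>)"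
proof -
  define N where "N = nat \<lfloor>real n powr \<alpha>\<rfloor>"
  define M where "M = nat \<lfloor>real n powr (1 - 2 * \<alpha>)\<rfloor>"
  define E where "E = link ` link_params M N"
  note N = floor_powr_bounds[OF n \<alpha>(1), folded N_def]
  have "1 - 2 * \<alpha> \<ge> 0"
    using \<alpha> by simp
  note M = floor_powr_bounds[OF n this, folded M_def]
  have n0: "real n > 0" "real n \<ge> 1"
    using n by auto

  have "real M * (real N)\<^sup>2 \<le> real n powr (1 - 2 * \<alpha>) * (real n powr \<alpha>)\<^sup>2"
    using M N by (intro mult_mono power_mono) auto
  also have "\<dots> = real n"
    using n0 by (simp add: power2_eq_square flip: powr_add)
  finally have MN2: "real M * (real N)\<^sup>2 \<le> real n" .
  then have "M * N\<^sup>2 \<le> n"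
    by (simp flip: of_nat_power of_nat_mult)
  then have "card (ratio_vertices M N) \<le> 2 * n"
    using card_ratio_vertices_le[of M N] by simp
  \<comment> \<open>Isolated vertices \<open>B\<close> make the number of vertices exactly \<open>2 * n\<close>.\<close>
  have "infinite (UNIV - ratio_vertices M N)"
    by (simp add: infinite_UNIV_char_0)
  then obtain B where B: "finite B" "card B = 2 * n - card (ratio_vertices M N)"
      "B \<subseteq> UNIV - ratio_vertices M N"
    using infinite_arbitrarily_large by blast
  define A where "A = ratio_vertices M N \<union> B"
  have A: "finite A" "card A = 2 * n"
    using B \<open>card (ratio_vertices M N) \<le> 2 * n\<close>
    by (simp_all add: A_def) (subst card_Un_disjoint; auto)

  have "real M * 1 \<le> real M * (real N)\<^sup>2" "1 * real N \<le> real M * (real N)\<^sup>2"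
    using M(1) N(1) by (intro mult_mono self_le_power; simp)+
  then have "M \<le> n" "N \<le> n"
    using MN2 by linarith+
  then have logs: "1 + ln (real (2 * M)) \<le> 1 + ln (real (2 * n))"
      "1 + ln (real (2 * N)) \<le> 1 + ln (real (2 * n))"
    using M(1) N(1) by auto
  have logs0: "0 \<le> 1 + ln (real (2 * M))" "0 \<le> 1 + ln (real (2 * N))"
    using M(1) N(1) by (auto intro!: add_nonneg_nonneg ln_ge_zero)
  have "(1 + ln (real (2 * M)))\<^sup>2 * (1 + ln (real (2 * N)))\<^sup>2
      \<le> (1 + ln (real (2 * n)))\<^sup>2 * (1 + ln (real (2 * n)))\<^sup>2"
    using logs logs0 by (intro mult_mono power_mono) auto
  then have L: "16 * (1 + ln (real (2 * M)))\<^sup>2 * (1 + ln (real (2 * N)))\<^sup>2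
      \<le> 16 * (1 + ln (real (2 * n))) ^ 4"
    by (simp add: power4_eq_xxxx power2_eq_square mult.assoc)
  have "real (2 * n) powr (2 - 2 * \<alpha>) = 2 powr (2 - 2 * \<alpha>) * real n powr (2 - 2 * \<alpha>)"
    by (simp add: powr_mult)
  also have "\<dots> \<le> 2 powr 2 * real n powr (2 - 2 * \<alpha>)"
    using \<alpha> by (intro mult_right_mono powr_mono) auto
  also have "real n powr (2 - 2 * \<alpha>) = (real n powr (1 - 2 * \<alpha>))\<^sup>2 * (real n powr \<alpha>)\<^sup>2"
    by (simp add: power2_eq_square flip: powr_add)
  also have "\<dots> \<le> (2 * real M)\<^sup>2 * (2 * real N)\<^sup>2"
    using M N by (intro mult_mono power_mono) auto
  also have "\<dots> = 16 * ((real M)\<^sup>2 * (real N)\<^sup>2)"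
    by (simp add: power_mult_distrib)
  also have "(real M)\<^sup>2 * (real N)\<^sup>2 \<le> real (card E) *
      (16 * (1 + ln (real (2 * M)))\<^sup>2 * (1 + ln (real (2 * N)))\<^sup>2)"
    unfolding E_def by (rule card_links_ge[OF M(1) N(1)])
  also have "\<dots> \<le> real (card E) * (16 * (1 + ln (real (2 * n))) ^ 4)"
    using L by (intro mult_left_mono) auto
  finally have edges: "real (2 * n) powr (2 - 2 * \<alpha>)
      \<le> 1024 * (1 + ln (real (2 * n))) ^ 4 * real (card E)"
    by (simp add: mult_ac)

  have "real (card (sumset_along A E)) \<le> 10 * (real M * real N ^ 3)"
    using card_sumset_links_le[of A M N, folded E_def, THEN of_nat_mono, where 'a = real] by simp
  also have "real M * real N ^ 3 \<le> real n powr (1 - 2 * \<alpha>) * (real n powr \<alpha>) ^ 3"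
    using M N by (intro mult_mono power_mono) auto
  also have "\<dots> = real n powr (1 + \<alpha>)"
    by (simp add: power3_eq_cube add.commute flip: powr_add)
  \<comment> \<open>The assumption \<open>\<alpha> \<le> 1 / 5\<close> keeps the sums below the bound for the products.\<close>
  also have "\<dots> \<le> real n powr (2 - 4 * \<alpha>)"
    using \<alpha> n0 by (intro powr_mono) auto
  finally have sums: "real (card (sumset_along A E)) \<le> 10 * real n powr (2 - 4 * \<alpha>)"
    by simp
  have "real (card (prodset_along A E)) \<le> 2 * (real M)\<^sup>2"
    using card_prodset_links_le[of A M N, folded E_def, THEN of_nat_mono, where 'a = real] by simp
  also have "(real M)\<^sup>2 \<le> (real n powr (1 - 2 * \<alpha>))\<^sup>2"
    using M by (intro power_mono) auto
  also have "\<dots> = real n powr (2 - 4 * \<alpha>)"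
    by (simp add: power2_eq_square flip: powr_add)
  finally have prods: "real (card (prodset_along A E)) \<le> 2 * real n powr (2 - 4 * \<alpha>)"
    by simp
  have "real n powr (2 - 4 * \<alpha>) \<le> real (2 * n) powr (2 - 4 * \<alpha>)"
    using \<alpha> by (intro powr_mono2) auto
  then have "real (card (sumset_along A E)) + real (card (prodset_along A E))
      \<le> 12 * real (2 * n) powr (2 - 4 * \<alpha>)"
    using sums prods by linarith
  moreover have "simple_graph A E"
    unfolding E_def by (rule simple_graph_links) (simp add: A_def)
  ultimately show ?thesis
    using A edges by blast
qed

theorem theorem2:
  "\<exists>c1 > 0. \<exists>c2 > 0. \<exists>d1 > 0. \<exists>d2 > 0.
     \<forall>(m0::nat) (\<alpha>::real). 0 \<le> \<alpha> \<and> \<alpha> \<le> 1 / 5 \<longrightarrow>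
       (\<exists>(m::nat) (A::real set) (E::real set set).
          m \<ge> m0 \<and> finite A \<and> card A = m \<and> simple_graph A E \<and>
          soft_Omega_bound c1 c2 (real (card E)) (real m powr (2 - 2 * \<alpha>)) \<and>
          soft_O_bound d1 d2
            (real (card (sumset_along A E)) + real (card (prodset_along A E)))
            (real (card A) powr (2 - 4 * \<alpha>)))"
proof -
  obtain n0 :: nat where n0: "1024 * (1 + ln (real n)) ^ 4 \<le> real n powr (3 / 5)" if "n \<ge> n0" for n
    using polylog_eventually_small by blast
  have "\<exists>(m::nat) (A::real set) (E::real set set).
          m \<ge> m0 \<and> finite A \<and> card A = m \<and> simple_graph A E \<and>
          soft_Omega_bound 16384 4 (real (card E)) (real m powr (2 - 2 * \<alpha>)) \<and>
          soft_O_bound 12 1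
            (real (card (sumset_along A E)) + real (card (prodset_along A E)))
            (real (card A) powr (2 - 4 * \<alpha>))"
    if \<alpha>: "0 \<le> \<alpha>" "\<alpha> \<le> 1 / 5" for m0 :: nat and \<alpha> :: real
  proof -
    define n where "n = m0 + n0 + 2"
    have "exp 1 \<le> (3::real)"
      by (rule exp_le)
    then have e: "exp 1 \<le> real (2 * n)"
      by (rule order_trans) (simp add: n_def)
    have large: "n \<ge> 1" "2 * n \<ge> m0" "2 * n \<ge> n0"
      by (auto simp: n_def)
    obtain A :: "real set" and E where G: "finite A" "card A = 2 * n" "simple_graph A E"
      and edges: "real (2 * n) powr (2 - 2 * \<alpha>)
        \<le> 1024 * (1 + ln (real (2 * n))) ^ 4 * real (card E)"
      and sums: "real (card (sumset_along A E)) + real (card (prodset_along A E))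
        \<le> 12 * real (2 * n) powr (2 - 4 * \<alpha>)"
      using ratio_graph_exists[OF large(1) \<alpha>] by blast
    have "soft_Omega_bound 16384 4 (real (card E)) (real (2 * n) powr (2 - 2 * \<alpha>))"
      using e n0[OF large(3)] \<alpha>(2) edges by (rule soft_Omega_bound_of_polylog_loss)
    moreover have "soft_O_bound 12 1
        (real (card (sumset_along A E)) + real (card (prodset_along A E)))
        (real (card A) powr (2 - 4 * \<alpha>))"
      unfolding G(2) using e _ _ sums by (rule soft_O_bound_of_le) (use \<alpha> in auto)
    ultimately show ?thesis
      using G large(2) by blast
  qed
  moreover have "(16384::real) > 0" "(4::real) > 0" "(12::real) > 0" "(1::real) > 0"
    by simp_all
  ultimately show ?thesis
    by blast
qed

end
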